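(* Let $K$ be an infinite field and $n\ge 1$ an integer. Let $K[\mathbf{x},\mathbf{y}]=K[x_1,y_1,\dots,x_n,y_n]$ and $f_{i,j}=x_iy_j-y_ix_j$ for $1\le i,j\le n$. An element $p\in K[\mathbf{x},\mathbf{y}]$ is invariant under the action of $\mathrm{SL}_2(K)$ if and only if $p$ can be written as a polynomial over $K$ in the $f_{i,j}$, $1\le i,j\le n$; that is, $$K[\mathbf{x},\mathbf{y}]^{\mathrm{SL}_2}=K[f_{i,j}:1\le i,j\le n].$$
   Context: The group $\mathrm{SL}_2(K)$ acts on $K[x_1,y_1,\dots,x_n,y_n]$ by matrix-vector multiplication on each pair of variables $(x_i,y_i)$: for $G=\begin{pmatrix}a&b\\c&d\end{pmatrix}$, the polynomial $G\cdot p$ is obtained from $p$ by substituting $x_i\mapsto ax_i+by_i$ and $y_i\mapsto cx_i+dy_i$ simultaneously for all $i$. The ring of polynomials fixed by all $G\in\mathrm{SL}_2(K)$ is denoted $K[\mathbf{x},\mathbf{y}]^{\mathrm{SL}_2}$. $K[f_{i,j}:1\le i,j\le n]$ denotes the $K$-subalgebra of $K[\mathbf{x},\mathbf{y}]$ generated by all $f_{i,j}$. *)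

theory Defs
  imports "HOL-Library.Poly_Mapping" "HOL-Analysis.Determinants"
begin

text \<open>
  A polynomial in variables of type \<open>'v\<close> is a finitely supported map from monomials to
  coefficients, a monomial being a finitely supported exponent map. With the convolution
  product of \<^theory>\<open>HOL-Library.Poly_Mapping\<close> this is a commutative ring.
\<close>

type_synonym ('v, 'k) mpoly = "('v \<Rightarrow>\<^sub>0 nat) \<Rightarrow>\<^sub>0 'k"

definition Const :: "'k::field \<Rightarrow> ('v, 'k) mpoly" where
  "Const c = Poly_Mapping.single 0 c"

definition Var :: "'v \<Rightarrow> ('v, 'k::field) mpoly" where
  "Var v = Poly_Mapping.single (Poly_Mapping.single v 1) 1"

definition vars :: "('v, 'k::field) mpoly \<Rightarrow> 'v set" where
  "vars p = (\<Union>m \<in> Poly_Mapping.keys p. Poly_Mapping.keys m)"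

definition polys_in :: "'v set \<Rightarrow> ('v, 'k::field) mpoly set" where
  "polys_in V = {p. vars p \<subseteq> V}"

definition subst :: "('v \<Rightarrow> ('w, 'k::field) mpoly) \<Rightarrow> ('v, 'k) mpoly \<Rightarrow> ('w, 'k) mpoly" where
  "subst \<sigma> p = (\<Sum>m \<in> Poly_Mapping.keys p.
     Const (Poly_Mapping.lookup p m) *
     (\<Prod>v \<in> Poly_Mapping.keys m. \<sigma> v ^ Poly_Mapping.lookup m v))"

text \<open>Closure under negation and scalar multiples follows from containing all constants.\<close>

definition subalgebra :: "('v, 'k::field) mpoly set \<Rightarrow> bool" where
  "subalgebra A \<longleftrightarrow> range Const \<subseteq> A \<and> (\<forall>p\<in>A. \<forall>q\<in>A. p + q \<in> A \<and> p * q \<in> A)"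

definition generated_subalgebra :: "('v, 'k::field) mpoly set \<Rightarrow> ('v, 'k) mpoly set" where
  "generated_subalgebra S = subalgebra hull S"

text \<open>
  The type \<open>xy\<close> has the variables \<open>x\<^sub>i\<close>, \<open>y\<^sub>i\<close> for every natural number \<open>i\<close>;
  the polynomial ring in \<open>2 n\<close> variables is the subring using only indices in \<open>{1..n}\<close>.
\<close>

datatype xy = X nat | Y nat

definition Kxy :: "nat \<Rightarrow> (xy, 'k::field) mpoly set" where
  "Kxy n = polys_in (X ` {1..n} \<union> Y ` {1..n})"

definition SL2 :: "('k::field ^ 2 ^ 2) set" where
  "SL2 = {G. det G = 1}"

fun act_var :: "'k::field ^ 2 ^ 2 \<Rightarrow> xy \<Rightarrow> (xy, 'k) mpoly" where
  "act_var G (X i) = Const (G $ 1 $ 1) * Var (X i) + Const (G $ 1 $ 2) * Var (Y i)"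
| "act_var G (Y i) = Const (G $ 2 $ 1) * Var (X i) + Const (G $ 2 $ 2) * Var (Y i)"

definition act :: "'k::field ^ 2 ^ 2 \<Rightarrow> (xy, 'k) mpoly \<Rightarrow> (xy, 'k) mpoly" where
  "act G p = subst (act_var G) p"

definition SL2_invariant :: "(xy, 'k::field) mpoly \<Rightarrow> bool" where
  "SL2_invariant p \<longleftrightarrow> (\<forall>G \<in> SL2. act G p = p)"

definition invariant_ring :: "nat \<Rightarrow> (xy, 'k::field) mpoly set" where
  "invariant_ring n = {p \<in> Kxy n. SL2_invariant p}"

definition bracket :: "nat \<Rightarrow> nat \<Rightarrow> (xy, 'k::field) mpoly" where
  "bracket i j = Var (X i) * Var (Y j) - Var (Y i) * Var (X j)"

end

theory Submission
  imports Defs "HOL-Computational_Algebra.Polynomial"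
begin

text \<open>
  Order monomials lexicographically by the exponents of \<open>y\<^sub>n, x\<^sub>n, \<dots>, y\<^sub>1, x\<^sub>1\<close>. For \<open>i < j\<close> the
  leading monomial of \<open>f\<^sub>i\<^sub>j\<close> is \<open>x\<^sub>i y\<^sub>j\<close>, so the leading monomials of products of brackets are the
  \<open>x\<^sup>a y\<^sup>b\<close> with \<open>|a| = |b|\<close> in which every \<open>y\<^sub>j\<close> can be matched with an \<open>x\<^sub>i\<close>, \<open>i < j\<close>; equivalently
  \<open>b\<^sub>1 + \<dots> + b\<^sub>k \<le> a\<^sub>1 + \<dots> + a\<^bsub>k-1\<^esub>\<close> for all \<open>k\<close>. The leading monomial of every invariant
  satisfies these conditions: \<open>|a| = |b|\<close> because of the torus, and the inequalities because of the
  substitutions \<open>y \<mapsto> y + s x\<close>. Subtracting a multiple of a product of brackets therefore lowers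
  the leading monomial of an invariant, and the order is well-founded.
\<close>

abbreviation "lookup \<equiv> Poly_Mapping.lookup"
abbreviation "keys \<equiv> Poly_Mapping.keys"
abbreviation "single \<equiv> Poly_Mapping.single"

section \<open>Polynomial rings and substitution\<close>

lemma Const_add: "Const (a + b) = Const a + Const b"
  by (simp add: Const_def single_add)

lemma Const_mult: "Const (a * b) = Const a * Const b"
  by (simp add: Const_def mult_single)

lemma Const_0 [simp]: "Const 0 = 0" and Const_1 [simp]: "Const 1 = 1"
  by (simp_all add: Const_def)

lemma Const_uminus: "Const (- a) = - Const a"
  by (simp add: Const_def single_uminus)

lemma Const_power: "Const (a ^ n) = Const a ^ n"
  by (induction n) (simp_all add: Const_mult)

lemma lookup_Const_mult [simp]: "lookup (Const c * p) m = c * lookup p m"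
proof -
  have "Const c * p = Poly_Mapping.map ((*) c) p"
    by (simp add: Const_def mult_map_scale_conv_mult)
  then show ?thesis
    by (simp add: map.rep_eq when_def)
qed

lemma Const_mult_single: "Const c * single m d = single m (c * d)"
  by (simp add: Const_def mult_single)

lemma sum_keys_single: "(\<Sum>m\<in>keys p. single m (lookup p m)) = p"
proof (rule poly_mapping_eqI)
  fix k
  show "lookup (\<Sum>m\<in>keys p. single m (lookup p m)) k = lookup p k"
    by (cases "k \<in> keys p")
      (auto simp: lookup_sum lookup_single when_def in_keys_iff)
qed

text \<open>The inner product of \<open>subst\<close>, split off because multiplicativity of
  \<open>subst\<close> rests on its multiplicativity in the exponent
  (\<open>mon_add\<close>).\<close>

definition mon :: "('v \<Rightarrow> ('w, 'k::field) mpoly) \<Rightarrow> ('v \<Rightarrow>\<^sub>0 nat) \<Rightarrow> ('w, 'k) mpoly" where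
  "mon \<sigma> m = (\<Prod>v\<in>keys m. \<sigma> v ^ lookup m v)"

lemma mon_superset:
  assumes "finite S" "keys m \<subseteq> S"
  shows "mon \<sigma> m = (\<Prod>v\<in>S. \<sigma> v ^ lookup m v)"
  unfolding mon_def using assms
  by (intro prod.mono_neutral_left) (auto simp: in_keys_iff)

lemma mon_add: "mon \<sigma> (m + m') = mon \<sigma> m * mon \<sigma> m'"
proof -
  let ?S = "keys m \<union> keys m'"
  have "mon \<sigma> (m + m') = (\<Prod>v\<in>?S. \<sigma> v ^ lookup (m + m') v)"
    by (intro mon_superset) (auto simp: keys_add)
  also have "\<dots> = mon \<sigma> m * mon \<sigma> m'"
    by (simp add: mon_superset[of ?S m] mon_superset[of ?S m'] lookup_add power_add prod.distrib)
  finally show ?thesis .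
qed

lemma mon_0 [simp]: "mon \<sigma> 0 = 1"
  by (simp add: mon_def)

lemma mon_single [simp]: "mon \<sigma> (single v k) = \<sigma> v ^ k"
  by (simp add: mon_def)

lemma Var_power: "Var v ^ k = single (single v k) 1"
  by (induction k) (simp_all add: Var_def mult_single flip: single_add)

lemma mon_Var: "mon Var m = (single m 1 :: ('v, 'k::field) mpoly)"
proof -
  have "(\<Prod>v\<in>A. single (f v) (1::'k)) = single (\<Sum>v\<in>A. f v) 1"
    if "finite A" for A and f :: "'v \<Rightarrow> 'v \<Rightarrow>\<^sub>0 nat"
    using that by (induction A) (simp_all add: mult_single)
  then show ?thesis
    by (simp add: mon_def Var_power sum_keys_single)
qed

lemma single_conv_mon: "single m c = Const c * mon Var m"
  by (simp add: mon_Var Const_mult_single)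

lemma subst_superset:
  assumes "finite S" "keys p \<subseteq> S"
  shows "subst \<sigma> p = (\<Sum>m\<in>S. Const (lookup p m) * mon \<sigma> m)"
  unfolding subst_def mon_def[symmetric] using assms
  by (intro sum.mono_neutral_left) (auto simp: in_keys_iff)

lemma subst_conv_mon: "subst \<sigma> p = (\<Sum>m\<in>keys p. Const (lookup p m) * mon \<sigma> m)"
  by (rule subst_superset) auto

lemma subst_0 [simp]: "subst \<sigma> 0 = 0"
  by (simp add: subst_def)

lemma subst_add: "subst \<sigma> (p + q) = subst \<sigma> p + subst \<sigma> q"
proof -
  let ?S = "keys p \<union> keys q"
  have "subst \<sigma> (p + q) = (\<Sum>m\<in>?S. Const (lookup (p + q) m) * mon \<sigma> m)"
    by (intro subst_superset) (auto simp: keys_add)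
  then show ?thesis
    by (simp add: subst_superset[of ?S p] subst_superset[of ?S q] lookup_add Const_add
        distrib_right sum.distrib)
qed

lemma subst_sum: "subst \<sigma> (\<Sum>i\<in>A. f i) = (\<Sum>i\<in>A. subst \<sigma> (f i))"
  by (induction A rule: infinite_finite_induct) (simp_all add: subst_add)

lemma subst_single: "subst \<sigma> (single m c) = Const c * mon \<sigma> m"
  by (subst subst_superset[of "{m}"]) auto

lemma subst_Const [simp]: "subst \<sigma> (Const c) = Const c"
  by (simp add: Const_def subst_single)

lemma subst_1 [simp]: "subst \<sigma> 1 = 1"
  using subst_Const[of \<sigma> 1] by simp

lemma subst_Var [simp]: "subst \<sigma> (Var v) = \<sigma> v"
  by (simp add: Var_def subst_single)

text \<open>Serves twice: for multiplicativity of \<open>subst\<close>, and later for the leading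
  coefficient of a product.\<close>

lemma mult_conv_sum_single:
  "p * q = (\<Sum>m\<in>keys p. \<Sum>m'\<in>keys q. single (m + m') (lookup p m * lookup q m'))"
proof -
  have "p * q = (\<Sum>m\<in>keys p. single m (lookup p m)) * (\<Sum>m\<in>keys q. single m (lookup q m))"
    by (simp add: sum_keys_single)
  then show ?thesis
    by (simp add: sum_product mult_single)
qed

lemma subst_mult: "subst \<sigma> (p * q) = subst \<sigma> p * subst \<sigma> q"
proof -
  have "subst \<sigma> (p * q) = (\<Sum>m\<in>keys p. \<Sum>m'\<in>keys q.
      Const (lookup p m) * mon \<sigma> m * (Const (lookup q m') * mon \<sigma> m'))"
    by (subst mult_conv_sum_single)
      (simp add: subst_sum subst_single Const_mult mon_add mult_ac)
  then show ?thesis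
    by (simp add: subst_conv_mon sum_product)
qed

lemma subst_power: "subst \<sigma> (p ^ n) = subst \<sigma> p ^ n"
  by (induction n) (simp_all add: subst_mult)

lemma subst_uminus: "subst \<sigma> (- p) = - subst \<sigma> p"
  using subst_add[of \<sigma> p "- p"] by (simp add: eq_neg_iff_add_eq_0 add.commute)

lemma subst_diff: "subst \<sigma> (p - q) = subst \<sigma> p - subst \<sigma> q"
  using subst_add[of \<sigma> p "- q"] by (simp add: subst_uminus)

lemma subst_cong:
  assumes "\<And>v. v \<in> vars p \<Longrightarrow> \<sigma> v = \<tau> v"
  shows "subst \<sigma> p = subst \<tau> p"
proof -
  have "mon \<sigma> m = mon \<tau> m" if "m \<in> keys p" for m
  proof -
    have "\<sigma> v = \<tau> v" if "v \<in> keys m" for v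
      using that \<open>m \<in> keys p\<close> by (intro assms) (auto simp: vars_def)
    then show ?thesis
      by (simp add: mon_def)
  qed
  then show ?thesis
    by (simp add: subst_conv_mon)
qed

text \<open>A polynomial is the sum of its terms. Identities between ring homomorphisms thus need
  checking on variables only, and \<open>subst\<close> maps into any subalgebra that contains the
  images of the variables.\<close>

lemma polys_in_induct [consumes 1, case_names Const Var add mult]:
  assumes p: "p \<in> polys_in V"
    and Const: "\<And>c. P (Const c)"
    and Var: "\<And>v. v \<in> V \<Longrightarrow> P (Var v)"
    and add: "\<And>p q. P p \<Longrightarrow> P q \<Longrightarrow> P (p + q)"
    and mult: "\<And>p q. P p \<Longrightarrow> P q \<Longrightarrow> P (p * q)"
  shows "P p"
proof -
  have power: "P (Var v ^ k)" if "v \<in> V" for v k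
    using Const[of 1] by (induction k) (simp_all add: mult Var that)
  have prod: "P (\<Prod>v\<in>A. Var v ^ f v)" if "finite A" "A \<subseteq> V" for A f
    using that Const[of 1] by (induction A) (simp_all add: mult power)
  have sum: "P (\<Sum>m\<in>A. f m)" if "finite A" "\<And>m. m \<in> A \<Longrightarrow> P (f m)"
    for A and f :: "('a \<Rightarrow>\<^sub>0 nat) \<Rightarrow> ('a, 'b) mpoly"
    using that Const[of 0] by (induction A) (simp_all add: add)
  have "P (\<Sum>m\<in>keys p. single m (lookup p m))"
  proof (rule sum)
    fix m assume "m \<in> keys p"
    then have "keys m \<subseteq> V"
      using p by (auto simp: polys_in_def vars_def)
    then show "P (single m (lookup p m))"
      unfolding single_conv_mon mon_def by (intro mult Const prod) auto
  qed simp
  then show ?thesis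
    by (simp add: sum_keys_single)
qed

lemma mpoly_induct [case_names Const Var add mult]:
  assumes "\<And>c. P (Const c)" "\<And>v. P (Var v)"
    and "\<And>p q. P p \<Longrightarrow> P q \<Longrightarrow> P (p + q)" "\<And>p q. P p \<Longrightarrow> P q \<Longrightarrow> P (p * q)"
  shows "P p"
proof -
  have "p \<in> polys_in UNIV"
    by (simp add: polys_in_def)
  then show ?thesis
    by (induction rule: polys_in_induct) (use assms in auto)
qed

section \<open>Variables occurring in a polynomial, and subalgebras\<close>

lemma vars_Const [simp]: "vars (Const c) = {}"
  by (auto simp: vars_def Const_def)

lemma vars_Var [simp]: "vars (Var v) = {v}"
  by (auto simp: vars_def Var_def)

lemma vars_add: "vars (p + q) \<subseteq> vars p \<union> vars q"
  using keys_add[of p q] by (auto simp: vars_def)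

lemma vars_mult: "vars (p * q) \<subseteq> vars p \<union> vars q"
proof
  fix v assume "v \<in> vars (p * q)"
  then obtain m where m: "m \<in> keys (p * q)" "v \<in> keys m"
    by (auto simp: vars_def)
  then obtain a b where "m = a + b" "a \<in> keys p" "b \<in> keys q"
    using keys_mult[of p q] by auto
  then show "v \<in> vars p \<union> vars q"
    using m keys_add[of a b] by (auto simp: vars_def)
qed

lemma subalgebra_polys_in: "subalgebra (polys_in V)"
  unfolding subalgebra_def polys_in_def
proof (intro conjI ballI)
  fix p q :: "('a, 'b) mpoly"
  assume "p \<in> {p. vars p \<subseteq> V}" "q \<in> {p. vars p \<subseteq> V}"
  then show "p + q \<in> {p. vars p \<subseteq> V}" "p * q \<in> {p. vars p \<subseteq> V}"
    using vars_add[of p q] vars_mult[of p q] by auto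
qed auto

lemma Var_in_polys_in: "v \<in> V \<Longrightarrow> Var v \<in> polys_in V"
  by (simp add: polys_in_def)

lemma subalgebraD:
  assumes "subalgebra A"
  shows "Const c \<in> A"
    and "p \<in> A \<Longrightarrow> q \<in> A \<Longrightarrow> p + q \<in> A"
    and "p \<in> A \<Longrightarrow> q \<in> A \<Longrightarrow> p * q \<in> A"
  using assms by (auto simp: subalgebra_def)

lemma subalgebra_diff:
  assumes "subalgebra A" "p \<in> A" "q \<in> A"
  shows "p - q \<in> A"
proof -
  have "p + Const (-1) * q \<in> A"
    using assms by (intro subalgebraD)
  then show ?thesis
    by (simp add: Const_uminus)
qed

section \<open>Polynomial dependence on a scalar\<close>

lemma poly_eq_0_infinite:
  fixes P :: "'k::field poly"
  assumes "infinite A" "\<And>s. s \<in> A \<Longrightarrow> poly P s = 0"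
  shows "P = 0"
proof (rule ccontr)
  assume "P \<noteq> 0"
  then have "finite {s. poly P s = 0}"
    by (rule poly_roots_finite)
  moreover have "A \<subseteq> {s. poly P s = 0}"
    using assms by blast
  ultimately show False
    using assms(1) finite_subset by blast
qed

lemma lookup_poly_Const:
  "lookup (poly P (Const s)) m = poly (map_poly (\<lambda>c. lookup c m) P) s"
proof (induction P)
  case (pCons c P)
  then show ?case
    by (cases "c = 0 \<and> P = 0") (auto simp: map_poly_pCons lookup_add)
qed simp

text \<open>Taken monomial by monomial, this is a univariate polynomial over \<open>'k\<close> with
  infinitely many roots. It permits comparing powers of a parameter s that takes only scalar
  values.\<close>

lemma poly_Const_eq_0:
  fixes P :: "('v, 'k::field) mpoly poly"
  assumes "infinite A" "\<And>s. s \<in> A \<Longrightarrow> poly P (Const s) = 0"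
  shows "P = 0"
proof (rule poly_eqI)
  fix i
  have "map_poly (\<lambda>c. lookup c m) P = 0" for m
    by (rule poly_eq_0_infinite[OF assms(1)]) (use assms(2) in \<open>simp flip: lookup_poly_Const\<close>)
  then have "lookup (coeff P i) m = 0" for m
    by (metis coeff_0 coeff_map_poly lookup_zero)
  then show "coeff P i = coeff 0 i"
    by (simp add: poly_mapping_eqI)
qed

text \<open>Families that are polynomial in s contain the constants and are closed under sums and
  products, so it suffices to control the images of the variables.\<close>

lemma subst_polynomial_family:
  fixes p :: "('v, 'k::field) mpoly" and \<sigma> :: "'k \<Rightarrow> 'v \<Rightarrow> ('w, 'k) mpoly"
  assumes "\<And>v. \<exists>P. \<forall>s. \<sigma> s v = poly P (Const s)"
  shows "\<exists>P. \<forall>s. subst (\<sigma> s) p = poly P (Const s)"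
proof (induction p rule: mpoly_induct)
  case (Const c)
  have "\<forall>s. subst (\<sigma> s) (Const c) = poly [:Const c:] (Const s)"
    by simp
  then show ?case by blast
next
  case (Var v)
  then show ?case using assms by simp
next
  case (add p q)
  then obtain P Q where "\<forall>s. subst (\<sigma> s) p = poly P (Const s)" "\<forall>s. subst (\<sigma> s) q = poly Q (Const s)"
    by blast
  then have "\<forall>s. subst (\<sigma> s) (p + q) = poly (P + Q) (Const s)"
    by (simp add: subst_add)
  then show ?case by blast
next
  case (mult p q)
  then obtain P Q where "\<forall>s. subst (\<sigma> s) p = poly P (Const s)" "\<forall>s. subst (\<sigma> s) q = poly Q (Const s)"
    by blast
  then have "\<forall>s. subst (\<sigma> s) (p * q) = poly (P * Q) (Const s)"
    by (simp add: subst_mult)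
  then show ?case by blast
qed

section \<open>The action on a subset of the vectors\<close>

fun index :: "xy \<Rightarrow> nat" where
  "index (X i) = i"
| "index (Y i) = i"

text \<open>Vectors with index outside \<open>S\<close> stay fixed, so that the last vector can be
  separated from the others in the induction on the number of vectors.\<close>

definition act_on :: "nat set \<Rightarrow> 'k::field ^ 2 ^ 2 \<Rightarrow> (xy, 'k) mpoly \<Rightarrow> (xy, 'k) mpoly" where
  "act_on S G = subst (\<lambda>v. if index v \<in> S then act_var G v else Var v)"

definition mat2 :: "'k \<Rightarrow> 'k \<Rightarrow> 'k \<Rightarrow> 'k \<Rightarrow> 'k::field ^ 2 ^ 2" where
  "mat2 a b c d = vector [vector [a, b], vector [c, d]]"

lemma mat2_nth [simp]:
  "mat2 a b c d $ 1 $ 1 = a" "mat2 a b c d $ 1 $ 2 = b"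
  "mat2 a b c d $ 2 $ 1 = c" "mat2 a b c d $ 2 $ 2 = d"
  by (simp_all add: mat2_def)

lemma mat2_mult:
  "mat2 a b c d ** mat2 a' b' c' d' =
     mat2 (a * a' + b * c') (a * b' + b * d') (c * a' + d * c') (c * b' + d * d')"
  by (simp add: vec_eq_iff forall_2 matrix_matrix_mult_def sum_2)

lemma act_on_0 [simp]: "act_on S G 0 = 0"
  and act_on_Const [simp]: "act_on S G (Const c) = Const c"
  and act_on_add: "act_on S G (p + q) = act_on S G p + act_on S G q"
  and act_on_mult: "act_on S G (p * q) = act_on S G p * act_on S G q"
  and act_on_sum: "act_on S G (sum f A) = (\<Sum>i\<in>A. act_on S G (f i))"
  and act_on_power: "act_on S G (p ^ n) = act_on S G p ^ n"
  by (simp_all add: act_on_def subst_add subst_mult subst_sum subst_power)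

text \<open>The factors appear in this order because acting is substitution: \<open>G\<close> is
  substituted into the linear forms given by the rows of \<open>G'\<close>.\<close>

lemma act_on_act_on: "act_on S G (act_on S G' p) = act_on S (G' ** G) p"
proof (induction p rule: mpoly_induct)
  case (Var v)
  show ?case
    by (cases v) (simp_all add: act_on_def subst_add subst_mult matrix_matrix_mult_def sum_2
        Const_add Const_mult algebra_simps)
qed (simp_all add: act_on_add act_on_mult)

lemma act_on_disjoint:
  assumes "S \<inter> T = {}"
  shows "act_on S G (act_on T G p) = act_on (S \<union> T) G p"
proof (induction p rule: mpoly_induct)
  case (Var v)
  show ?case
    using assms by (cases v) (auto simp: act_on_def subst_add subst_mult)
qed (simp_all add: act_on_add act_on_mult)

lemma act_on_mat1: "act_on S (mat2 1 0 0 1) p = p"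
proof (induction p rule: mpoly_induct)
  case (Var v)
  show ?case
    by (cases v) (simp_all add: act_on_def)
qed (simp_all add: act_on_add act_on_mult)

lemma act_on_cancel:
  "G ** G' = mat2 1 0 0 1 \<Longrightarrow> act_on S G' (act_on S G p) = p"
  by (simp add: act_on_act_on act_on_mat1)

lemma act_conv_act_on:
  assumes "p \<in> Kxy n"
  shows "act G p = act_on {1..n} G p"
  unfolding act_def act_on_def
  using assms by (intro subst_cong) (auto simp: Kxy_def polys_in_def)

section \<open>Bidegrees and diagonal matrices\<close>

definition xdeg :: "nat set \<Rightarrow> (xy \<Rightarrow>\<^sub>0 nat) \<Rightarrow> nat" where
  "xdeg S m = (\<Sum>i\<in>S. lookup m (X i))"

definition ydeg :: "nat set \<Rightarrow> (xy \<Rightarrow>\<^sub>0 nat) \<Rightarrow> nat" where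
  "ydeg S m = (\<Sum>i\<in>S. lookup m (Y i))"

lemma Const_prod: "Const (\<Prod>v\<in>A. f v) = (\<Prod>v\<in>A. Const (f v))"
  by (induction A rule: infinite_finite_induct) (simp_all add: Const_mult)

lemma mon_scale: "mon (\<lambda>v. Const (c v) * Var v) m = Const (\<Prod>v\<in>keys m. c v ^ lookup m v) * mon Var m"
  by (simp add: mon_def power_mult_distrib prod.distrib Const_power Const_prod)

text \<open>Diagonal matrices scale each variable, so monomials are eigenvectors, with eigenvalue
  determined by the bidegree in the vectors of \<open>S\<close>.\<close>

lemma lookup_act_on_diag:
  assumes "finite S"
  shows "lookup (act_on S (mat2 \<alpha> 0 0 \<beta>) p) m = \<alpha> ^ xdeg S m * \<beta> ^ ydeg S m * lookup p m"
proof -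
  define c where "c v = (if index v \<in> S then case v of X _ \<Rightarrow> \<alpha> | Y _ \<Rightarrow> \<beta> else 1)" for v
  have c: "(\<Prod>v\<in>keys m. c v ^ lookup m v) = \<alpha> ^ xdeg S m * \<beta> ^ ydeg S m" for m
  proof -
    have "(\<Prod>v\<in>keys m. c v ^ lookup m v) = (\<Prod>v\<in>keys m \<union> (X ` S \<union> Y ` S). c v ^ lookup m v)"
      using assms by (intro prod.mono_neutral_left) (auto simp: in_keys_iff)
    also have "\<dots> = (\<Prod>v\<in>X ` S \<union> Y ` S. c v ^ lookup m v)"
    proof (intro prod.mono_neutral_right ballI)
      fix v assume "v \<in> keys m \<union> (X ` S \<union> Y ` S) - (X ` S \<union> Y ` S)"
      then have "index v \<notin> S"
        by (cases v) auto
      then show "c v ^ lookup m v = 1"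
        by (simp add: c_def)
    qed (use assms in auto)
    also have "\<dots> = (\<Prod>v\<in>X ` S. c v ^ lookup m v) * (\<Prod>v\<in>Y ` S. c v ^ lookup m v)"
      using assms by (intro prod.union_disjoint) auto
    also have "(\<Prod>v\<in>X ` S. c v ^ lookup m v) = \<alpha> ^ xdeg S m"
      by (subst prod.reindex) (auto simp: inj_on_def c_def xdeg_def power_sum)
    also have "(\<Prod>v\<in>Y ` S. c v ^ lookup m v) = \<beta> ^ ydeg S m"
      by (subst prod.reindex) (auto simp: inj_on_def c_def ydeg_def power_sum)
    finally show ?thesis .
  qed
  have "(\<lambda>v. if index v \<in> S then act_var (mat2 \<alpha> 0 0 \<beta>) v else Var v) = (\<lambda>v. Const (c v) * Var v)"
  proof
    fix v show "(if index v \<in> S then act_var (mat2 \<alpha> 0 0 \<beta>) v else Var v) = Const (c v) * Var v"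
      by (cases v) (auto simp: c_def)
  qed
  then have "act_on S (mat2 \<alpha> 0 0 \<beta>) p =
      (\<Sum>m\<in>keys p. single m (\<alpha> ^ xdeg S m * \<beta> ^ ydeg S m * lookup p m))"
    by (simp only: act_on_def subst_conv_mon mon_scale c mon_Var Const_mult_single mult.assoc)
      (simp add: mult_ac)
  then show ?thesis
    by (cases "m \<in> keys p") (auto simp: lookup_sum lookup_single when_def in_keys_iff)
qed

text \<open>
  In characteristic 0 this says that lowering a vector of weight \<open>-m\<close> in a representation of
  the Lie algebra \<open>sl\<^sub>2\<close> fewer than \<open>m\<close> times cannot annihilate it. In general, the lower
  unitriangular matrix \<open>y \<mapsto> y + s x\<close> followed by \<open>x \<mapsto> x - y / s\<close> is a torus element times
  \<open>(x \<mapsto> s x - y, y \<mapsto> x)\<close>, and one compares the powers of \<open>s\<close>.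
\<close>
lemma lowering_degree:
  fixes q :: "(xy, 'k::field) mpoly"
  assumes inf: "infinite (UNIV :: 'k set)" and S: "finite S"
    and weight: "\<And>h. h \<in> keys q \<Longrightarrow> ydeg S h = xdeg S h + m"
    and P: "\<And>s. act_on S (mat2 1 0 s 1) q = poly P (Const s)" and "P \<noteq> 0"
  shows "m \<le> degree P"
proof (rule ccontr)
  define d where "d = degree P"
  assume "\<not> m \<le> degree P"
  then have d: "d < m" by (simp add: d_def)
  \<comment> \<open>All matrix entries used below are affine in the parameter; this is the form that
    \<open>subst_polynomial_family\<close> needs on variables.\<close>
  have lin: "\<exists>P. \<forall>s. Const (a * s + b) * p + Const (c * s + e) * q = poly P (Const s)"
    for a b c e :: 'k and p q :: "(xy, 'k) mpoly"
  proof -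
    have "\<forall>s. Const (a * s + b) * p + Const (c * s + e) * q =
        poly [:Const b * p + Const e * q, Const a * p + Const c * q:] (Const s)"
      by (simp add: Const_add Const_mult algebra_simps)
    then show ?thesis by blast
  qed
  have const: "\<exists>P. \<forall>s. p = poly P (Const s)" for p :: "(xy, 'k) mpoly"
    using lin[of 0 1 p 0 0 0] by simp
  have "\<exists>R. \<forall>s. act_on S (mat2 s (-1) 1 0) q = poly R (Const s)"
    unfolding act_on_def
  proof (rule subst_polynomial_family)
    fix v show "\<exists>P. \<forall>s. (if index v \<in> S then act_var (mat2 s (-1) 1 0) v else Var v) = poly P (Const (s :: 'k))"
      using lin[of 1 0 "Var (X (index v))" 0 "-1" "Var (Y (index v))"] const
      by (cases "index v \<in> S"; cases v) simp_all
  qed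
  then obtain R where R: "\<And>s. act_on S (mat2 s (-1) 1 0) q = poly R (Const s)"
    by blast
  have "\<exists>Q. \<forall>r. act_on S (mat2 1 r 0 1) p = poly Q (Const r)" for p :: "(xy, 'k) mpoly"
    unfolding act_on_def
  proof (rule subst_polynomial_family)
    fix v show "\<exists>P. \<forall>s. (if index v \<in> S then act_var (mat2 1 s 0 1) v else Var v) = poly P (Const (s :: 'k))"
      using lin[of 0 1 "Var (X (index v))" 1 0 "Var (Y (index v))"] const
      by (cases "index v \<in> S"; cases v) simp_all
  qed
  then have "\<forall>i. \<exists>Q. \<forall>r. act_on S (mat2 1 r 0 1) (coeff P i) = poly Q (Const r)"
    by blast
  then obtain Q where Q: "\<And>i r. act_on S (mat2 1 r 0 1) (coeff P i) = poly (Q i) (Const r)"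
    unfolding choice_iff by blast
  \<comment> \<open>Multiplying by s^N clears the negative powers of s in \<open>Q i\<close> at
    \<open>- inverse s\<close> for all i <= d; \<open>T\<close> is the polynomial that
    results.\<close>
  define N where "N = (\<Sum>i\<le>d. degree (Q i))"
  have N: "degree (Q i) \<le> N" if "i \<le> d" for i
    unfolding N_def using that by (intro member_le_sum) auto
  define T where "T = (\<Sum>i\<le>d. \<Sum>k\<le>N. monom (coeff (Q i) k * (-1) ^ k) (i + (N - k)))"
  have "monom 1 (N + m) * R - T = 0"
  proof (rule poly_Const_eq_0)
    show "infinite (UNIV - {0 :: 'k})"
      using inf by simp
    fix s :: 'k assume "s \<in> UNIV - {0}"
    then have s: "s \<noteq> 0" by simp
    \<comment> \<open>By the weight hypothesis all monomials of \<open>q\<close> share the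
      eigenvalue s^m.\<close>
    have "act_on S (mat2 (inverse s) 0 0 s) q = Const (s ^ m) * q"
    proof (rule poly_mapping_eqI)
      fix h show "lookup (act_on S (mat2 (inverse s) 0 0 s) q) h = lookup (Const (s ^ m) * q) h"
      proof (cases "h \<in> keys q")
        case True
        then show ?thesis
          using s by (simp add: lookup_act_on_diag[OF S] weight power_add power_inverse)
      next
        case False
        then show ?thesis
          by (simp add: lookup_act_on_diag[OF S] in_keys_iff)
      qed
    qed
    then have "Const (s ^ m) * poly R (Const s) =
        act_on S (mat2 s (-1) 1 0) (act_on S (mat2 (inverse s) 0 0 s) q)"
      by (simp add: act_on_mult R)
    \<comment> \<open>Both compositions are the action of
      \<open>mat2 1 (- inverse s) s 0\<close>.\<close>
    also have "\<dots> = act_on S (mat2 1 (- inverse s) 0 1) (act_on S (mat2 1 0 s 1) q)"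
      using s by (simp add: act_on_act_on mat2_mult)
    also have "\<dots> = (\<Sum>i\<le>d. poly (Q i) (Const (- inverse s)) * Const s ^ i)"
      by (simp add: P poly_altdef[of P] act_on_sum act_on_mult act_on_power Q d_def)
    finally have *: "Const (s ^ m) * poly R (Const s) = \<dots>" .
    have "poly (monom 1 (N + m) * R) (Const s) = Const s ^ N * (Const (s ^ m) * poly R (Const s))"
      by (simp add: poly_monom power_add Const_power mult_ac)
    also have "\<dots> = (\<Sum>i\<le>d. Const s ^ N * poly (Q i) (Const (- inverse s)) * Const s ^ i)"
      unfolding * by (simp add: mult_ac sum_distrib_left)
    also have "\<dots> = poly T (Const s)"
      unfolding T_def poly_sum
    proof (rule sum.cong)
      fix i assume "i \<in> {..d}"
      then have "poly (Q i) (Const (- inverse s)) = (\<Sum>k\<le>N. coeff (Q i) k * Const (- inverse s) ^ k)"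
        using N[of i] unfolding poly_altdef by (intro sum.mono_neutral_left) (auto simp: coeff_eq_0)
      moreover have *: "Const s ^ N * Const (- inverse s) ^ k = (-1) ^ k * Const s ^ (N - k)"
        if "k \<le> N" for k
      proof -
        have "s ^ N * (- inverse s) ^ k = (-1) ^ k * s ^ (N - k)"
        proof -
          have "s ^ N = s ^ (N - k) * s ^ k"
            using that by (simp flip: power_add)
          moreover have "s ^ k * (- inverse s) ^ k = (-1) ^ k"
            using s by (simp flip: power_mult_distrib)
          ultimately show ?thesis
            by (metis mult.assoc mult.commute)
        qed
        then have "Const (s ^ N * (- inverse s) ^ k) = Const ((-1) ^ k * s ^ (N - k))"
          by simp
        then show ?thesis
          by (simp add: Const_mult Const_power Const_uminus)
      qed
      ultimately have "Const s ^ N * poly (Q i) (Const (- inverse s)) * Const s ^ i =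
          (\<Sum>k\<le>N. coeff (Q i) k * (Const s ^ N * Const (- inverse s) ^ k) * Const s ^ i)"
        by (simp add: sum_distrib_left sum_distrib_right mult_ac)
      also have "\<dots> = (\<Sum>k\<le>N. coeff (Q i) k * ((-1) ^ k * Const s ^ (N - k)) * Const s ^ i)"
        by (intro sum.cong refl) (simp only: atMost_iff *)
      finally show "Const s ^ N * poly (Q i) (Const (- inverse s)) * Const s ^ i =
          (\<Sum>k\<le>N. poly (monom (coeff (Q i) k * (-1) ^ k) (i + (N - k))) (Const s))"
        by (simp only: poly_monom power_add mult_ac)
    qed simp
    finally show "poly (monom 1 (N + m) * R - T) (Const s) = 0"
      by simp
  qed
  \<comment> \<open>The left side is the constant term of \<open>R\<close>, while \<open>T\<close>
    has degree at most N + d < N + m.\<close>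
  then have "coeff (monom 1 (N + m) * R) (N + m) = coeff T (N + m)"
    by simp
  also have "coeff T (N + m) = 0"
    using d by (auto simp: T_def coeff_sum intro!: sum.neutral)
  finally have "coeff R 0 = 0"
    by (simp add: coeff_monom_mult)
  \<comment> \<open>This is \<open>R\<close> at s = 0, where the matrix is still invertible, so
    \<open>q\<close> itself must vanish.\<close>
  then have "act_on S (mat2 0 (-1) 1 0) q = 0"
    by (simp add: R poly_0_coeff_0)
  then have "q = 0"
    using act_on_cancel[of "mat2 0 (-1) 1 0" "mat2 0 1 (-1) 0" S q] by (simp add: mat2_mult)
  then have "P = 0"
    using poly_Const_eq_0[OF inf, of P] P by simp
  then show False
    using \<open>P \<noteq> 0\<close> by simp
qed

section \<open>Leading monomials of unipotent invariants\<close>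

text \<open>Projection onto the span of the monomials satisfying \<open>Q\<close>; it cuts out the
  part with prescribed exponents in the last vector.\<close>

definition restr :: "(('v \<Rightarrow>\<^sub>0 nat) \<Rightarrow> bool) \<Rightarrow> ('v, 'k::field) mpoly \<Rightarrow> ('v, 'k) mpoly" where
  "restr Q p = (\<Sum>m\<in>{m\<in>keys p. Q m}. single m (lookup p m))"

lemma lookup_restr: "lookup (restr Q p) m = (if Q m then lookup p m else 0)"
  by (auto simp: restr_def lookup_sum lookup_single when_def in_keys_iff)

lemma keys_restr: "keys (restr Q p) = {m\<in>keys p. Q m}"
  by (auto simp: in_keys_iff lookup_restr split: if_splits)

lemma restr_sum: "restr Q (\<Sum>i\<in>A. f i) = (\<Sum>i\<in>A. restr Q (f i))"
  by (rule poly_mapping_eqI) (simp add: lookup_restr lookup_sum)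

lemma restr_single: "restr Q (single m c) = (if Q m then single m c else 0)"
  by (rule poly_mapping_eqI) (auto simp: lookup_restr lookup_single when_def)

lemma act_on_conv_sum: "act_on S G p = (\<Sum>m\<in>keys p. act_on S G (single m (lookup p m)))"
  by (subst sum_keys_single[of p, symmetric]) (simp add: act_on_sum)

text \<open>A variable with index in \<open>S\<close> becomes a linear form in the two variables of
  that index; all others are kept.\<close>

lemma keys_act_on_single:
  assumes "m' \<in> keys (act_on S G (single m c))" "index v \<notin> S"
  shows "lookup m' v = lookup m v"
proof -
  \<comment> \<open>Under products of polynomials the exponents on the right add, so the relation
    passes from variables to whole monomials.\<close>
  define agrees where "agrees p m \<longleftrightarrow> (\<forall>m'\<in>keys p. \<forall>v. index v \<notin> S \<longrightarrow> lookup m' v = lookup m v)"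
    for p :: "(xy, 'a) mpoly" and m
  define \<sigma> where "\<sigma> = (\<lambda>v. if index v \<in> S then act_var G v else Var v)"
  have one: "agrees 1 0"
    by (simp add: agrees_def)
  have mult: "agrees (p * q) (m + m')" if "agrees p m" "agrees q m'" for p q m m'
    unfolding agrees_def
  proof (intro ballI allI impI)
    fix k v assume "k \<in> keys (p * q)" and v: "index v \<notin> S"
    then obtain a b where "k = a + b" "a \<in> keys p" "b \<in> keys q"
      using keys_mult[of p q] by auto
    then show "lookup k v = lookup (m + m') v"
      using that v by (simp add: agrees_def lookup_add)
  qed
  have \<sigma>: "agrees (\<sigma> v) (single v 1)" for v
  proof (cases "index v \<in> S")
    case True
    have "vars (act_var G v) \<subseteq> {X (index v), Y (index v)}"
      by (cases v) (auto dest!: subsetD[OF vars_add] subsetD[OF vars_mult])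
    then have "u = X (index v) \<or> u = Y (index v)" if "m' \<in> keys (\<sigma> v)" "u \<in> keys m'" for m' u
      using that True by (auto simp: \<sigma>_def vars_def)
    then have "lookup m' u = 0" if "m' \<in> keys (\<sigma> v)" "index u \<notin> S" for m' u
      using that True by (metis in_keys_iff index.simps)
    then show ?thesis
      using True by (auto simp: agrees_def lookup_single when_def)
  next
    case False
    then show ?thesis
      by (simp add: \<sigma>_def agrees_def Var_def)
  qed
  have power: "agrees (\<sigma> v ^ k) (single v k)" for v k
  proof (induction k)
    case (Suc k)
    then show ?case
      using mult[OF \<sigma> Suc, of v] by (simp flip: single_add)
  qed (simp add: one)
  have prod: "agrees (\<Prod>v\<in>A. \<sigma> v ^ f v) (\<Sum>v\<in>A. single v (f v))" if "finite A" for A f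
    using that by (induction A) (simp_all add: one mult power)
  have "agrees (Const c) 0"
    by (simp add: agrees_def Const_def)
  from mult[OF this prod[of "keys m" "lookup m"]]
  have "agrees (act_on S G (single m c)) m"
    by (simp add: act_on_def subst_single mon_def \<sigma>_def sum_keys_single)
  then show ?thesis
    using assms by (simp add: agrees_def)
qed

text \<open>By hypothesis \<open>Q\<close> sees only exponents outside \<open>S\<close>, and these
  are untouched by the action.\<close>

lemma restr_act_on:
  assumes "\<And>m m'. (\<And>v. index v \<notin> S \<Longrightarrow> lookup m v = lookup m' v) \<Longrightarrow> Q m = Q m'"
  shows "restr Q (act_on S G p) = act_on S G (restr Q p)"
proof -
  have "restr Q (act_on S G (single m c)) = (if Q m then act_on S G (single m c) else 0)" for m c
  proof (rule poly_mapping_eqI)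
    fix k
    show "lookup (restr Q (act_on S G (single m c))) k =
        lookup (if Q m then act_on S G (single m c) else 0) k"
    proof (cases "k \<in> keys (act_on S G (single m c))")
      case True
      then have "Q k = Q m"
        by (intro assms keys_act_on_single)
      then show ?thesis
        by (simp add: lookup_restr)
    next
      case False
      then show ?thesis
        by (simp add: lookup_restr in_keys_iff)
    qed
  qed
  then have "restr Q (act_on S G p) =
      (\<Sum>m\<in>keys p. if Q m then act_on S G (single m (lookup p m)) else 0)"
    by (subst act_on_conv_sum) (simp add: restr_sum)
  also have "\<dots> = act_on S G (restr Q p)"
    by (simp add: restr_def act_on_sum sum.inter_filter if_distrib[of "act_on S G"]
        cong: if_cong)
  finally show ?thesis .
qed

section \<open>The substitution y -> y + s x on a single vector\<close>

definition shift :: "nat \<Rightarrow> nat \<Rightarrow> (xy \<Rightarrow>\<^sub>0 nat) \<Rightarrow> (xy \<Rightarrow>\<^sub>0 nat)" where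
  "shift i j m = m - single (Y i) j + single (X i) j"

lemma lookup_shift:
  "lookup (shift i j m) v =
     (if v = X i then lookup m v + j else if v = Y i then lookup m v - j else lookup m v)"
  by (simp add: shift_def lookup_add lookup_minus lookup_single when_def)

lemma shift_0 [simp]: "shift i 0 m = m"
  by (simp add: shift_def)

text \<open>The binomial theorem for a power of s x_i + y_i; \<open>shift i j\<close> trades j
  factors y_i for x_i.\<close>

lemma act_on_lower_single:
  "act_on {i} (mat2 1 0 s 1) (single m c) =
     (\<Sum>j\<le>lookup m (Y i). single (shift i j m) (c * of_nat (lookup m (Y i) choose j) * s ^ j))"
proof -
  define b where "b = lookup m (Y i)"
  define m0 where "m0 = m - single (Y i) b"
  have m: "m = m0 + single (Y i) b"
    by (rule poly_mapping_eqI) (auto simp: m0_def b_def lookup_add lookup_minus lookup_single when_def)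
  have *: "single (m0 + single (Y i) k) 1 = mon Var m0 * Var (Y i) ^ k" for k
    by (simp add: mon_Var Var_power mult_single)
  have "mon (\<lambda>v. if index v \<in> {i} then act_var (mat2 1 0 s 1) v else Var v) m0 = mon Var m0"
    unfolding mon_def
  proof (intro prod.cong refl)
    fix v assume "v \<in> keys m0"
    then have "v \<noteq> Y i"
      by (auto simp: m0_def b_def in_keys_iff lookup_minus)
    then show "(if index v \<in> {i} then act_var (mat2 1 0 s 1) v else Var v) ^ lookup m0 v = Var v ^ lookup m0 v"
      by (cases v) auto
  qed
  then have "act_on {i} (mat2 1 0 s 1) (single m c) =
      Const c * mon Var m0 * (Const s * Var (X i) + Var (Y i)) ^ b"
    by (simp add: act_on_def subst_single m mon_add mult.assoc)
  also have "\<dots> = (\<Sum>j\<le>b. Const c * mon Var m0 *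
      (of_nat (b choose j) * (Const s * Var (X i)) ^ j * Var (Y i) ^ (b - j)))"
    by (simp add: binomial_ring sum_distrib_left)
  also have "\<dots> = (\<Sum>j\<le>b. single (shift i j m) (c * of_nat (b choose j) * s ^ j))"
  proof (rule sum.cong)
    fix j assume "j \<in> {..b}"
    then have "shift i j m = m0 + single (X i) j + single (Y i) (b - j)"
      by (intro poly_mapping_eqI)
        (auto simp: lookup_shift lookup_add lookup_single when_def m0_def lookup_minus b_def)
    then have "single (shift i j m) 1 = (mon Var m0 * Var (X i) ^ j * Var (Y i) ^ (b - j) :: (xy, 'a) mpoly)"
      by (simp add: mon_Var Var_power mult_single)
    moreover have "of_nat (b choose j) = (Const (of_nat (b choose j)) :: (xy, 'a) mpoly)"
      by (simp add: Const_def)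
    moreover have "single (shift i j m) (c * of_nat (b choose j) * s ^ j) =
        Const (c * of_nat (b choose j) * s ^ j) * single (shift i j m) 1"
      by (simp add: Const_mult_single)
    ultimately show "Const c * mon Var m0 *
        (of_nat (b choose j) * (Const s * Var (X i)) ^ j * Var (Y i) ^ (b - j)) =
        single (shift i j m) (c * of_nat (b choose j) * s ^ j)"
      by (simp only: Const_mult Const_power power_mult_distrib mult_ac)
  qed simp
  finally show ?thesis
    by (simp add: b_def)
qed

lemma restr_act_on_lower:
  "restr Q (act_on {i} (mat2 1 0 s 1) p) =
     (\<Sum>m\<in>keys p. \<Sum>j\<le>lookup m (Y i). if Q (shift i j m)
        then single (shift i j m) (lookup p m * of_nat (lookup m (Y i) choose j) * s ^ j) else 0)"
  by (subst act_on_conv_sum) (simp add: act_on_lower_single restr_sum restr_single cong: if_cong)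

text \<open>The highest index is compared first, so that the recursion peels off the same vector as
  the induction below. Indices outside 1 to \<open>n\<close> are ignored.\<close>

fun lexless :: "nat \<Rightarrow> (xy \<Rightarrow>\<^sub>0 nat) \<Rightarrow> (xy \<Rightarrow>\<^sub>0 nat) \<Rightarrow> bool" where
  "lexless 0 m m' \<longleftrightarrow> False"
| "lexless (Suc n) m m' \<longleftrightarrow>
     lookup m (Y (Suc n)) < lookup m' (Y (Suc n)) \<or>
     lookup m (Y (Suc n)) = lookup m' (Y (Suc n)) \<and>
       (lookup m (X (Suc n)) < lookup m' (X (Suc n)) \<or>
        lookup m (X (Suc n)) = lookup m' (X (Suc n)) \<and> lexless n m m')"

text \<open>The half-open range on the right reflects the strict inequality i < j in the leading
  monomial x_i y_j; for k = 1 it excludes y_1.\<close>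

definition ballot :: "nat \<Rightarrow> (xy \<Rightarrow>\<^sub>0 nat) \<Rightarrow> bool" where
  "ballot n m \<longleftrightarrow> (\<forall>k\<in>{1..n}. ydeg {1..k} m \<le> xdeg {1..<k} m)"

text \<open>Induction on n, splitting off the vector N = n + 1. The part of \<open>p\<close> with
  the greatest exponents of y_N and then x_N is invariant in the first n vectors and supplies the
  leading monomial. Its weight there differs from that of \<open>p\<close>, hence the arbitrary
  \<open>w\<close>.\<close>

lemma unipotent_invariant_leading_monomial:
  fixes p :: "(xy, 'k::field) mpoly"
  assumes inf: "infinite (UNIV :: 'k set)"
    and "p \<noteq> 0"
    and "\<And>s. act_on {1..n} (mat2 1 0 s 1) p = p"
    and "\<And>m. m \<in> keys p \<Longrightarrow> int (xdeg {1..n} m) - int (ydeg {1..n} m) = w"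
  shows "\<exists>m\<in>keys p. ballot n m \<and> (\<forall>m'\<in>keys p. \<not> lexless n m m')"
  using assms(2-)
proof (induction n arbitrary: p w)
  case 0
  then obtain m where "m \<in> keys p"
    by fastforce
  then show ?case
    by (auto simp: ballot_def)
next
  case (Suc n)
  define N where "N = Suc n"
  define b where "b = Max ((\<lambda>m. lookup m (Y N)) ` keys p)"
  define a where "a = Max ((\<lambda>m. lookup m (X N)) ` {m\<in>keys p. lookup m (Y N) = b})"
  have nonempty: "keys p \<noteq> {}"
    using Suc.prems by simp
  have b_max: "lookup m (Y N) \<le> b" if "m \<in> keys p" for m
    using that by (simp add: b_def)
  have a_max: "lookup m (X N) \<le> a" if "m \<in> keys p" "lookup m (Y N) = b" for m
    using that by (simp add: a_def)
  have "b \<in> (\<lambda>m. lookup m (Y N)) ` keys p"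
    unfolding b_def using nonempty by (intro Max_in) auto
  then have "a \<in> (\<lambda>m. lookup m (X N)) ` {m\<in>keys p. lookup m (Y N) = b}"
    unfolding a_def by (intro Max_in) auto
  then obtain m0 where m0: "m0 \<in> keys p" "lookup m0 (Y N) = b" "lookup m0 (X N) = a"
    by auto
  have upto: "{1..Suc n} = insert N {1..n}" and N_notin: "N \<notin> {1..n}"
    by (auto simp: N_def)
  have xdeg_N: "xdeg {1..Suc n} m = xdeg {1..n} m + lookup m (X N)"
    and ydeg_N: "ydeg {1..Suc n} m = ydeg {1..n} m + lookup m (Y N)" for m
    by (simp_all add: xdeg_def ydeg_def N_def)
  \<comment> \<open>The actions on disjoint sets of vectors compose to the full action, so on
    \<open>p\<close> the first n vectors can be traded for the inverse on vector N.\<close>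
  have inv: "act_on {1..n} (mat2 1 0 s 1) p = act_on {N} (mat2 1 0 (-s) 1) p" for s
  proof -
    have "p = act_on {N} (mat2 1 0 s 1) (act_on {1..n} (mat2 1 0 s 1) p)"
      using N_notin Suc.prems(2)[of s, unfolded upto] by (subst act_on_disjoint) simp_all
    then show ?thesis
      using act_on_cancel[of "mat2 1 0 s 1" "mat2 1 0 (-s) 1" "{N}" "act_on {1..n} (mat2 1 0 s 1) p"]
      by (simp add: mat2_mult)
  qed
  have restr_inv: "act_on {1..n} (mat2 1 0 s 1) (restr (\<lambda>m. lookup m (X N) = i \<and> lookup m (Y N) = j) p) =
      restr (\<lambda>m. lookup m (X N) = i \<and> lookup m (Y N) = j) (act_on {N} (mat2 1 0 (-s) 1) p)" for s i j
    unfolding inv[symmetric] using N_notin by (intro restr_act_on[symmetric]) auto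

  define q where "q = restr (\<lambda>m. lookup m (X N) = a \<and> lookup m (Y N) = b) p"
  have keys_q: "keys q = {m\<in>keys p. lookup m (X N) = a \<and> lookup m (Y N) = b}"
    by (simp add: q_def keys_restr)
  \<comment> \<open>\<open>shift N j\<close> lowers the exponent of y_N by j. As \<open>b\<close> is
    the maximum, only j = 0 lands in the slice.\<close>
  have "act_on {1..n} (mat2 1 0 s 1) q = q" for s
  proof -
    have "(\<Sum>j\<le>lookup m (Y N). if lookup (shift N j m) (X N) = a \<and> lookup (shift N j m) (Y N) = b
        then single (shift N j m) (lookup p m * of_nat (lookup m (Y N) choose j) * (-s) ^ j) else 0) =
      (if lookup m (X N) = a \<and> lookup m (Y N) = b then single m (lookup p m) else 0)"
      if m: "m \<in> keys p" for m
    proof -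
      have "(\<Sum>j\<le>lookup m (Y N). if lookup (shift N j m) (X N) = a \<and> lookup (shift N j m) (Y N) = b
        then single (shift N j m) (lookup p m * of_nat (lookup m (Y N) choose j) * (-s) ^ j) else 0) =
        (\<Sum>j\<in>{0}. if lookup (shift N j m) (X N) = a \<and> lookup (shift N j m) (Y N) = b
        then single (shift N j m) (lookup p m * of_nat (lookup m (Y N) choose j) * (-s) ^ j) else 0)"
        using b_max[OF m] by (intro sum.mono_neutral_right) (auto simp: lookup_shift)
      then show ?thesis by simp
    qed
    then show ?thesis
      unfolding q_def restr_inv restr_act_on_lower
      by (simp add: restr_def sum.inter_filter)
  qed
  moreover have "q \<noteq> 0"
    using m0 keys_q by auto
  moreover have "int (xdeg {1..n} m) - int (ydeg {1..n} m) = w - int a + int b" if "m \<in> keys q" for m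
    using that Suc.prems(3)[of m] by (simp add: keys_q xdeg_N ydeg_N del: One_nat_def)
  ultimately have "\<exists>m\<in>keys q. ballot n m \<and> (\<forall>m'\<in>keys q. \<not> lexless n m m')"
    by (intro Suc.IH)
  then obtain m where m: "m \<in> keys q" "ballot n m" "\<forall>m'\<in>keys q. \<not> lexless n m m'"
    by blast

  text \<open>
    The coefficient \<open>q'\<close> of \<open>x\<^sub>N\<^bsup>a+b\<^esup>\<close> has weight \<open>w - a - b\<close> in the first \<open>n\<close> vectors. By invariance,
    \<open>y \<mapsto> y + s x\<close> acts on it as the inverse acts on the \<open>N\<close>-th vector, so it is a polynomial in
    \<open>s\<close> of degree at most \<open>b\<close>, and \<open>lowering_degree\<close> gives \<open>a \<le> w\<close>.
\<close>
  define q' where "q' = restr (\<lambda>m. lookup m (X N) = a + b \<and> lookup m (Y N) = 0) p"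
  define M where "M = {m\<in>keys p. lookup m (X N) + lookup m (Y N) = a + b}"
  define P where "P = (\<Sum>m\<in>M. monom (single (shift N (lookup m (Y N)) m)
      (lookup p m * (-1) ^ lookup m (Y N))) (lookup m (Y N)))"
  \<comment> \<open>Only the full shift removes y_N, and its binomial coefficient is 1. The exponent
    of x_N is then a + b exactly for monomials in \<open>M\<close>.\<close>
  have q'_P: "act_on {1..n} (mat2 1 0 s 1) q' = poly P (Const s)" for s
  proof -
    have "(\<Sum>j\<le>lookup m (Y N). if lookup (shift N j m) (X N) = a + b \<and> lookup (shift N j m) (Y N) = 0
        then single (shift N j m) (lookup p m * of_nat (lookup m (Y N) choose j) * (-s) ^ j) else 0) =
      (if lookup m (X N) + lookup m (Y N) = a + b then
        poly (monom (single (shift N (lookup m (Y N)) m)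
          (lookup p m * (-1) ^ lookup m (Y N))) (lookup m (Y N))) (Const s) else 0)" for m
    proof -
      have "(\<Sum>j\<le>lookup m (Y N). if lookup (shift N j m) (X N) = a + b \<and> lookup (shift N j m) (Y N) = 0
        then single (shift N j m) (lookup p m * of_nat (lookup m (Y N) choose j) * (-s) ^ j) else 0) =
        (\<Sum>j\<in>{lookup m (Y N)}. if lookup (shift N j m) (X N) = a + b \<and> lookup (shift N j m) (Y N) = 0
        then single (shift N j m) (lookup p m * of_nat (lookup m (Y N) choose j) * (-s) ^ j) else 0)"
        by (intro sum.mono_neutral_right) (auto simp: lookup_shift)
      moreover have "single k (lookup p m * (-s) ^ j) = single k (lookup p m * (-1) ^ j) * Const s ^ j"
        for k :: "xy \<Rightarrow>\<^sub>0 nat" and j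
        by (simp add: Const_mult_single mult_ac power_minus[of s] flip: Const_power)
      ultimately show ?thesis
        by (simp add: lookup_shift poly_monom)
    qed
    then show ?thesis
      unfolding q'_def restr_inv restr_act_on_lower P_def M_def
      by (simp add: sum.inter_filter poly_sum if_distrib[of "\<lambda>x. poly x (Const s)"] cong: if_cong)
  qed
  \<comment> \<open>The contribution of \<open>m0\<close> cannot cancel, since
    \<open>shift N b\<close> is injective on monomials with y_N-exponent \<open>b\<close>.\<close>
  have "lookup (coeff P b) (shift N b m0) =
      (\<Sum>m\<in>M. if m = m0 then lookup p m * (-1) ^ b else 0)"
    unfolding P_def coeff_sum lookup_sum
  proof (rule sum.cong)
    fix m assume "m \<in> M"
    have "m = m0" if "lookup m (Y N) = b" "shift N b m = shift N b m0"
    proof (rule poly_mapping_eqI)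
      fix v show "lookup m v = lookup m0 v"
        using that(1) m0(2) arg_cong[OF that(2), of "\<lambda>m. lookup m v"]
        by (simp add: lookup_shift split: if_splits)
    qed
    then show "lookup (coeff (monom (single (shift N (lookup m (Y N)) m)
          (lookup p m * (-1) ^ lookup m (Y N))) (lookup m (Y N))) b) (shift N b m0) =
        (if m = m0 then lookup p m * (-1) ^ b else 0)"
      using m0(2) by (auto simp: lookup_single when_def)
  qed simp
  also have "\<dots> = lookup p m0 * (-1) ^ b"
    using m0 by (simp add: M_def)
  finally have "lookup (coeff P b) (shift N b m0) \<noteq> 0"
    using m0(1) by (simp add: in_keys_iff)
  then have "P \<noteq> 0"
    by fastforce
  have "degree P \<le> b"
    unfolding P_def
    using b_max by (intro degree_sum_le) (auto simp: M_def intro!: order.trans[OF degree_monom_le])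
  \<comment> \<open>For a negative left side the bound is trivial; otherwise it is the natural
    number fed to \<open>lowering_degree\<close>.\<close>
  have "int a + int b - w \<le> int b"
  proof (cases "int a + int b - w < 0")
    case False
    have "nat (int a + int b - w) \<le> degree P"
    proof (rule lowering_degree[OF inf _ _ q'_P \<open>P \<noteq> 0\<close>])
      fix h assume "h \<in> keys q'"
      then show "ydeg {1..n} h = xdeg {1..n} h + nat (int a + int b - w)"
        using False Suc.prems(3)[of h] by (simp add: q'_def keys_restr xdeg_N ydeg_N del: One_nat_def)
    qed simp
    then show ?thesis
      using \<open>degree P \<le> b\<close> by linarith
  qed simp
  \<comment> \<open>The one ballot inequality beyond the induction hypothesis: in the first n
    vectors \<open>m\<close> has weight w - a + b >= b.\<close>
  then have "ydeg {1..Suc n} m \<le> xdeg {1..<Suc n} m"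
    using m(1) Suc.prems(3)[of m] by (simp add: keys_q xdeg_N ydeg_N atLeastLessThanSuc_atLeastAtMost
        del: One_nat_def)
  then have "ballot (Suc n) m"
    using m(2) by (auto simp: ballot_def le_Suc_eq)
  moreover have "\<not> lexless (Suc n) m m'" if "m' \<in> keys p" for m'
  proof
    assume less: "lexless (Suc n) m m'"
    have "lookup m (X N) = a" "lookup m (Y N) = b"
      using m(1) by (simp_all add: keys_q)
    then have "lookup m' (X N) = a \<and> lookup m' (Y N) = b \<and> lexless n m m'"
      using less b_max[OF that] a_max[OF that] by (auto simp: N_def)
    then show False
      using m(3) that unfolding keys_q by blast
  qed
  ultimately show ?case
    using m(1) unfolding keys_q by blast
qed

section \<open>Leading monomials of products of brackets\<close>

lemma lexless_irrefl: "\<not> lexless n m m"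
  by (induction n) auto

lemma lexless_trans: "lexless n a b \<Longrightarrow> lexless n b c \<Longrightarrow> lexless n a c"
  by (induction n) auto

lemma lexless_add_right: "lexless n a b \<Longrightarrow> lexless n (a + c) (b + c)"
  by (induction n) (auto simp: lookup_add)

lemma lexless_add_mono:
  assumes "lexless n a a' \<or> a = a'" "lexless n b b' \<or> b = b'" "a \<noteq> a' \<or> b \<noteq> b'"
  shows "lexless n (a + b) (a' + b')"
  using assms lexless_add_right[of n a a' b] lexless_add_right[of n b b' a']
    lexless_trans[of n "a + b" "a' + b" "a' + b'"]
  by (auto simp: add.commute)

definition xy_vars :: "nat \<Rightarrow> xy set" where
  "xy_vars n = X ` {1..n} \<union> Y ` {1..n}"

text \<open>The supports are confined because \<open>lexless n\<close> cannot separate monomials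
  that differ only in other variables.\<close>

lemma lexless_total:
  assumes "keys m \<subseteq> xy_vars n" "keys m' \<subseteq> xy_vars n"
  shows "m = m' \<or> lexless n m m' \<or> lexless n m' m"
proof -
  have "(\<forall>i\<in>{1..n}. lookup m (X i) = lookup m' (X i) \<and> lookup m (Y i) = lookup m' (Y i)) \<or>
      lexless n m m' \<or> lexless n m' m"
    by (induction n) (auto simp: le_Suc_eq)
  moreover have "m = m'"
    if eq: "\<forall>i\<in>{1..n}. lookup m (X i) = lookup m' (X i) \<and> lookup m (Y i) = lookup m' (Y i)"
  proof (rule poly_mapping_eqI)
    fix v show "lookup m v = lookup m' v"
    proof (cases "v \<in> xy_vars n")
      case True
      then show ?thesis
        using eq by (auto simp: xy_vars_def)
    next
      case False
      then have "v \<notin> keys m" "v \<notin> keys m'"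
        using assms by auto
      then show ?thesis
        by (simp add: in_keys_iff)
    qed
  qed
  ultimately show ?thesis by blast
qed

text \<open>Each recursion step is a lexicographic product with the natural numbers. This makes the
  reduction of invariants terminate.\<close>

lemma wf_lexless: "wf {(m, m'). lexless n m m'}"
proof (induction n)
  case (Suc n)
  have "wf (inv_image (less_than <*lex*> (less_than <*lex*> {(m, m'). lexless n m m'}))
      (\<lambda>m. (lookup m (Y (Suc n)), lookup m (X (Suc n)), m)))"
    using Suc by (intro wf_inv_image wf_lex_prod) auto
  moreover have "{(m, m'). lexless (Suc n) m m'} =
      inv_image (less_than <*lex*> (less_than <*lex*> {(m, m'). lexless n m m'}))
      (\<lambda>m. (lookup m (Y (Suc n)), lookup m (X (Suc n)), m))"
    by (auto simp: inv_image_def)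
  ultimately show ?case by simp
qed simp

section \<open>Leading terms with coefficient 1\<close>

definition monic_lead :: "nat \<Rightarrow> (xy, 'k::field) mpoly \<Rightarrow> (xy \<Rightarrow>\<^sub>0 nat) \<Rightarrow> bool" where
  "monic_lead n p m \<longleftrightarrow> lookup p m = 1 \<and> (\<forall>m'\<in>keys p. m' \<noteq> m \<longrightarrow> lexless n m' m)"

lemma monic_lead_1: "monic_lead n 1 0"
  by (simp add: monic_lead_def)

text \<open>Every other pair of terms has a strictly smaller product, so the leading term comes from
  one pair only and cannot cancel.\<close>

lemma monic_lead_mult:
  assumes p: "monic_lead n p m" and q: "monic_lead n q m'"
  shows "monic_lead n (p * q) (m + m')"
proof -
  have less: "lexless n (k + k') (m + m')" if "k \<in> keys p" "k' \<in> keys q" "k \<noteq> m \<or> k' \<noteq> m'" for k k'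
    using that p q by (intro lexless_add_mono) (auto simp: monic_lead_def)
  have iff: "k + k' = m + m' \<longleftrightarrow> k = m \<and> k' = m'" if "k \<in> keys p" "k' \<in> keys q" for k k'
    using less[OF that] lexless_irrefl[of n "m + m'"] by metis
  have "lookup (p * q) (m + m') =
      (\<Sum>k\<in>keys p. \<Sum>k'\<in>keys q. if k = m \<and> k' = m' then lookup p k * lookup q k' else 0)"
    by (subst mult_conv_sum_single)
      (auto simp: lookup_sum lookup_single when_def iff intro!: sum.cong)
  also have "\<dots> = (\<Sum>k\<in>keys p. if k = m then lookup p k * lookup q m' else 0)"
    by (intro sum.cong) (auto simp: in_keys_iff)
  also have "\<dots> = 1"
    using p q by (auto simp: monic_lead_def in_keys_iff)
  finally have "lookup (p * q) (m + m') = 1" .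
  moreover have "lexless n l (m + m')" if l: "l \<in> keys (p * q)" "l \<noteq> m + m'" for l
  proof -
    obtain k k' where "l = k + k'" "k \<in> keys p" "k' \<in> keys q"
      using l(1) keys_mult[of p q] by auto
    then show ?thesis
      using less l(2) by auto
  qed
  ultimately show ?thesis
    by (simp add: monic_lead_def)
qed

text \<open>No index above j occurs, and y_j, the first variable compared at j, divides only one of
  the two monomials.\<close>

lemma monic_lead_bracket:
  assumes "i < j" "j \<le> n"
  shows "monic_lead n (bracket i j) (single (X i) 1 + single (Y j) 1)"
proof -
  define m where "m = single (X i) 1 + single (Y j) (1::nat)"
  define m' where "m' = single (Y i) 1 + single (X j) (1::nat)"
  have br: "bracket i j = single m 1 - single m' 1"
    by (simp add: bracket_def Var_def mult_single m_def m'_def)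
  have lookup_m: "lookup m v = (if v = X i \<or> v = Y j then 1 else 0)"
    and lookup_m': "lookup m' v = (if v = Y i \<or> v = X j then 1 else 0)" for v
    by (auto simp: m_def m'_def lookup_add lookup_single when_def)
  have less: "lexless n m' m"
    using assms(2)
  proof (induction n)
    case 0
    then show ?case using assms(1) by simp
  next
    case (Suc n)
    then show ?case
      using assms(1) by (cases "j = Suc n") (auto simp: lookup_m lookup_m')
  qed
  then have "m' \<noteq> m"
    using lexless_irrefl by auto
  then show ?thesis
    using less unfolding m_def[symmetric]
    by (auto simp: monic_lead_def br lookup_minus lookup_single when_def in_keys_iff split: if_splits)
qed

text \<open>Induction on the number of factors y: split off some x_i y_j with i < j, the leading
  monomial of a bracket, so that the quotient is again ballot.\<close>

lemma ballot_monomial_is_lead: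
  assumes A: "subalgebra A" "\<And>i j. i \<in> {1..n} \<Longrightarrow> j \<in> {1..n} \<Longrightarrow> bracket i j \<in> A"
    and "keys m \<subseteq> xy_vars n" "ballot n m" "xdeg {1..n} m = ydeg {1..n} m"
  shows "\<exists>p\<in>A. monic_lead n p m"
  using assms(3-)
proof (induction "ydeg {1..n} m" arbitrary: m)
  case 0
  then have "\<forall>i\<in>{1..n}. lookup m (X i) = 0 \<and> lookup m (Y i) = 0"
    by (simp add: xdeg_def ydeg_def)
  then have "m = 0"
    using 0(2) by (intro poly_mapping_eqI) (auto simp: xy_vars_def in_keys_iff)
  moreover have "1 \<in> A"
    using subalgebraD(1)[OF A(1), of 1] by simp
  ultimately show ?case
    using monic_lead_1 by blast
next
  case (Suc d)
  define P where "P j \<longleftrightarrow> j \<in> {1..n} \<and> lookup m (Y j) > 0" for j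
  \<comment> \<open>For the least j with y_j present, the ballot condition at k = j yields some x_i
    with i < j.\<close>
  define j where "j = (LEAST j. P j)"
  have "\<exists>j. P j"
  proof (rule ccontr)
    assume "\<not> (\<exists>j. P j)"
    then have "ydeg {1..n} m = 0"
      by (simp add: P_def ydeg_def)
    then show False
      using Suc.hyps(2) by simp
  qed
  then have "P j"
    unfolding j_def by (rule LeastI_ex)
  then have j: "j \<in> {1..n}" "lookup m (Y j) > 0"
    by (simp_all add: P_def)
  have before_j: "lookup m (Y k) = 0" if "k \<in> {1..n}" "k < j" for k
    using not_less_Least[of k P] that by (auto simp: P_def j_def)
  have "lookup m (Y j) \<le> ydeg {1..j} m"
    using j(1) unfolding ydeg_def by (intro member_le_sum) auto
  also have "\<dots> \<le> xdeg {1..<j} m"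
    using Suc.prems(2) j(1) by (simp add: ballot_def)
  finally have "xdeg {1..<j} m \<noteq> 0"
    using j(2) by simp
  then obtain i where i: "i \<in> {1..<j}" "lookup m (X i) > 0"
    by (auto simp: xdeg_def)
  define e where "e = single (X i) 1 + single (Y j) (1::nat)"
  define m' where "m' = m - e"
  have lookup_e: "lookup e v = (if v = X i \<or> v = Y j then 1 else 0)" for v
    by (auto simp: e_def lookup_add lookup_single when_def)
  have m: "m = e + m'"
    using i(2) j(2) by (intro poly_mapping_eqI) (auto simp: m'_def lookup_add lookup_minus lookup_e)
  have xdeg: "xdeg S m = xdeg S m' + (if i \<in> S then 1 else 0)"
    and ydeg: "ydeg S m = ydeg S m' + (if j \<in> S then 1 else 0)" if "finite S" for S
    using that by (simp_all add: m xdeg_def ydeg_def lookup_add lookup_e sum.distrib)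
  have "\<exists>p\<in>A. monic_lead n p m'"
  proof (rule Suc.hyps(1))
    show "d = ydeg {1..n} m'"
      using Suc.hyps(2) j(1) by (simp add: ydeg)
    show "keys m' \<subseteq> xy_vars n"
      using Suc.prems(1) by (auto simp: m'_def in_keys_iff lookup_minus)
    show "ballot n m'"
      unfolding ballot_def
    proof
      fix k assume k: "k \<in> {1..n}"
      show "ydeg {1..k} m' \<le> xdeg {1..<k} m'"
      \<comment> \<open>Below j there is no y to count; from j on both sides drop by exactly one,
        because i < j <= k.\<close>
      proof (cases "k < j")
        case True
        then have "ydeg {1..k} m = 0"
          using before_j k by (simp add: ydeg_def)
        then show ?thesis
          by (simp add: ydeg)
      next
        case False
        moreover have "ydeg {1..k} m \<le> xdeg {1..<k} m"
          using Suc.prems(2) k by (simp add: ballot_def)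
        ultimately show ?thesis
          using i(1) j(1) by (simp add: ydeg xdeg)
      qed
    qed
    show "xdeg {1..n} m' = ydeg {1..n} m'"
      using Suc.prems(3) i(1) j(1) by (simp add: ydeg xdeg)
  qed
  then obtain p where p: "p \<in> A" "monic_lead n p m'"
    by blast
  have "monic_lead n (bracket i j * p) m"
    unfolding m e_def using i(1) j(1) p(2) by (intro monic_lead_mult monic_lead_bracket) auto
  moreover have "bracket i j * p \<in> A"
    using A(1) A(2)[of i j] i(1) j(1) p(1) by (auto simp: subalgebra_def)
  ultimately show ?case
    by blast
qed

section \<open>The invariant ring\<close>

lemma act_add: "act G (p + q) = act G p + act G q"
  and act_mult: "act G (p * q) = act G p * act G q"
  and act_Const: "act G (Const c) = Const c"
  by (simp_all add: act_def subst_add subst_mult)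

lemma subalgebra_invariant_ring: "subalgebra (invariant_ring n)"
  using subalgebra_polys_in[of "xy_vars n"]
  by (auto simp: subalgebra_def invariant_ring_def SL2_invariant_def act_add act_mult act_Const
      Kxy_def xy_vars_def)

text \<open>The bracket is the determinant of the matrix with columns (x_i, y_i) and (x_j, y_j),
  which \<open>G\<close> multiplies from the left.\<close>

lemma act_bracket: "act G (bracket i j) = Const (det G) * bracket i j"
  by (simp add: act_def bracket_def subst_diff subst_mult det_2 Const_mult Const_add Const_uminus
      diff_conv_add_uminus[of "_ * _ :: 'a"] algebra_simps del: add_uminus_conv_diff)

lemma bracket_in_invariant_ring:
  assumes "i \<in> {1..n}" "j \<in> {1..n}"
  shows "bracket i j \<in> invariant_ring n"
proof -
  have "bracket i j \<in> Kxy n"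
    unfolding bracket_def Kxy_def
    using assms by (intro subalgebra_diff subalgebraD(3) subalgebra_polys_in Var_in_polys_in) auto
  then show ?thesis
    by (simp add: invariant_ring_def SL2_invariant_def SL2_def act_bracket)
qed

lemma act_on_invariant:
  assumes "p \<in> invariant_ring n" "det G = 1"
  shows "act_on {1..n} G p = p"
  using assms act_conv_act_on[of p n G] by (simp add: invariant_ring_def SL2_invariant_def SL2_def)

text \<open>The matrix diag(s, 1/s) multiplies the coefficient at \<open>m\<close> by s^(a - b).
  Equality of s^a and s^b for infinitely many s forces a = b.\<close>

lemma invariant_weight:
  fixes p :: "(xy, 'k::field) mpoly"
  assumes inf: "infinite (UNIV :: 'k set)" and p: "p \<in> invariant_ring n" and m: "m \<in> keys p"
  shows "xdeg {1..n} m = ydeg {1..n} m"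
proof -
  define a where "a = xdeg {1..n} m"
  define b where "b = ydeg {1..n} m"
  have "monom 1 a - monom 1 b = (0 :: 'k poly)"
  proof (rule poly_eq_0_infinite)
    show "infinite (UNIV - {0 :: 'k})"
      using inf by simp
    fix s :: 'k assume "s \<in> UNIV - {0}"
    then have s: "s \<noteq> 0" by simp
    then have "act_on {1..n} (mat2 s 0 0 (inverse s)) p = p"
      by (intro act_on_invariant[OF p]) (simp add: det_2)
    then have "s ^ a * inverse s ^ b * lookup p m = lookup p m"
      using lookup_act_on_diag[of "{1..n}" s "inverse s" p m] by (simp add: a_def b_def)
    then have "s ^ a * inverse s ^ b = 1"
      using m by (simp add: in_keys_iff)
    then have "s ^ a = s ^ b"
      using s by (simp add: field_simps)
    then show "poly (monom 1 a - monom 1 b) s = 0"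
      by (simp add: poly_monom)
  qed
  then show ?thesis
    by (simp add: a_def b_def monom_eq_iff')
qed

lemma invariant_leading_monomial:
  fixes p :: "(xy, 'k::field) mpoly"
  assumes inf: "infinite (UNIV :: 'k set)" and p: "p \<in> invariant_ring n" and "p \<noteq> 0"
  shows "\<exists>m\<in>keys p. ballot n m \<and> (\<forall>m'\<in>keys p. m' \<noteq> m \<longrightarrow> lexless n m' m)"
proof -
  have "\<exists>m\<in>keys p. ballot n m \<and> (\<forall>m'\<in>keys p. \<not> lexless n m m')"
  proof (rule unipotent_invariant_leading_monomial[OF inf \<open>p \<noteq> 0\<close>])
    fix s :: 'k
    show "act_on {1..n} (mat2 1 0 s 1) p = p"
      by (intro act_on_invariant[OF p]) (simp add: det_2)
  next
    fix m assume "m \<in> keys p"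
    then show "int (xdeg {1..n} m) - int (ydeg {1..n} m) = 0"
      using invariant_weight[OF inf p] by simp
  qed
  moreover have "keys m \<subseteq> xy_vars n" if "m \<in> keys p" for m
    using that p by (auto simp: invariant_ring_def Kxy_def polys_in_def vars_def xy_vars_def)
  ultimately show ?thesis
    using lexless_total by meson
qed

text \<open>Leading terms are cancelled repeatedly by elements of \<open>A\<close>. As
  \<open>A\<close> consists of invariants, each remainder is again invariant.\<close>

lemma invariant_ring_subset:
  fixes A :: "(xy, 'k::field) mpoly set"
  assumes inf: "infinite (UNIV :: 'k set)"
    and A: "subalgebra A" "\<And>i j. i \<in> {1..n} \<Longrightarrow> j \<in> {1..n} \<Longrightarrow> bracket i j \<in> A"
    and A_inv: "A \<subseteq> invariant_ring n"
  shows "invariant_ring n \<subseteq> A"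
proof -
  have reduce: "\<exists>q\<in>A. \<exists>m\<in>keys p. \<forall>m'\<in>keys (p - q). lexless n m' m"
    if p: "p \<in> invariant_ring n" "p \<noteq> 0" for p
  proof -
    obtain m where m: "m \<in> keys p" "ballot n m" "\<forall>m'\<in>keys p. m' \<noteq> m \<longrightarrow> lexless n m' m"
      using invariant_leading_monomial[OF inf p] by blast
    have "keys m \<subseteq> xy_vars n"
      using m(1) p(1) by (auto simp: invariant_ring_def Kxy_def polys_in_def vars_def xy_vars_def)
    then obtain q where q: "q \<in> A" "monic_lead n q m"
      using ballot_monomial_is_lead[OF A _ m(2) invariant_weight[OF inf p(1) m(1)]] by blast
    have "lexless n m' m" if m': "m' \<in> keys (p - Const (lookup p m) * q)" for m'
    proof -
      have "m' \<noteq> m"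
        using m' q(2) by (auto simp: monic_lead_def in_keys_iff lookup_minus)
      moreover have "m' \<in> keys p \<or> m' \<in> keys q"
        using m' by (auto simp: in_keys_iff lookup_minus)
      ultimately show ?thesis
        using m(3) q(2) by (auto simp: monic_lead_def)
    qed
    moreover have "Const (lookup p m) * q \<in> A"
      using A(1) q(1) by (auto simp: subalgebra_def)
    ultimately show ?thesis
      using m(1) by blast
  qed
  \<comment> \<open>The induction runs on a strict upper bound for the monomials, which makes sense
    for the zero polynomial too.\<close>
  have below: "p \<in> A" if "p \<in> invariant_ring n" "\<forall>m'\<in>keys p. lexless n m' m" for p m
    using wf_lexless[of n] that
  proof (induction m arbitrary: p rule: wf_induct_rule)
    case (less m)
    show ?case
    proof (cases "p = 0")
      case True
      then show ?thesis
        using subalgebraD(1)[OF A(1), of 0] by simp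
    next
      case False
      obtain q m1 where q: "q \<in> A" "m1 \<in> keys p" "\<forall>m'\<in>keys (p - q). lexless n m' m1"
        using reduce[OF less.prems(1) False] by blast
      have "p - q \<in> invariant_ring n"
        using less.prems(1) q(1) A_inv by (intro subalgebra_diff subalgebra_invariant_ring) auto
      then have "p - q \<in> A"
        using less.prems(2) q by (intro less.IH[of m1]) auto
      then have "(p - q) + q \<in> A"
        using A(1) q(1) unfolding subalgebra_def by blast
      then show ?thesis by simp
    qed
  qed
  show ?thesis
  proof
    fix p :: "(xy, 'k) mpoly" assume p: "p \<in> invariant_ring n"
    show "p \<in> A"
    proof (cases "p = 0")
      case True
      then show ?thesis
        using subalgebraD(1)[OF A(1), of 0] by simp
    next
      case False
      \<comment> \<open>One reduction step produces the upper bound \<open>m1\<close> with which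
        \<open>below\<close> starts.\<close>
      obtain q m1 where q: "q \<in> A" "\<forall>m'\<in>keys (p - q). lexless n m' m1"
        using reduce[OF p False] by blast
      have "p - q \<in> invariant_ring n"
        using p q(1) A_inv by (intro subalgebra_diff subalgebra_invariant_ring) auto
      then have "(p - q) + q \<in> A"
        using A(1) q below unfolding subalgebra_def by blast
      then show ?thesis by simp
    qed
  qed
qed

theorem mainTheorem2:
  fixes n :: nat
  assumes "infinite (UNIV :: 'k::field set)"
    and "n \<ge> 1"
  shows "(\<forall>p \<in> (Kxy n :: (xy, 'k) mpoly set).
            SL2_invariant p \<longleftrightarrow>
              (\<exists>q \<in> polys_in ({1..n} \<times> {1..n}). p = subst (\<lambda>(i, j). bracket i j) q))
       \<and> (invariant_ring n :: (xy, 'k) mpoly set) =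
           generated_subalgebra {bracket i j | i j. i \<in> {1..n} \<and> j \<in> {1..n}}"
proof -
  define B :: "(xy, 'k) mpoly set" where "B = {bracket i j | i j. i \<in> {1..n} \<and> j \<in> {1..n}}"
  define V where "V = {1..n} \<times> {1..n}"
  \<comment> \<open>The image of evaluation at the brackets. It is a subalgebra contained in every
    subalgebra that contains the brackets, so both halves of the theorem follow from
    \<open>invariant_ring n = R\<close>.\<close>
  define R :: "(xy, 'k) mpoly set" where "R = subst (\<lambda>(i, j). bracket i j) ` polys_in V"
  have R_subset: "R \<subseteq> A" if A: "subalgebra A" "B \<subseteq> A" for A
  proof
    fix p assume "p \<in> R"
    then obtain q where q: "q \<in> polys_in V" "p = subst (\<lambda>(i, j). bracket i j) q"
      by (auto simp: R_def)
    from q(1) have "subst (\<lambda>(i, j). bracket i j) q \<in> A"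
    proof (induction rule: polys_in_induct)
      case (Const c)
      then show ?case using A(1) by (auto simp: subalgebra_def)
    next
      case (Var v)
      then obtain i j where v: "v = (i, j)" "i \<in> {1..n}" "j \<in> {1..n}"
        unfolding V_def by blast
      then have "bracket i j \<in> B"
        unfolding B_def by blast
      then show ?case using A(2) v(1) by auto
    next
      case (add p q)
      then show ?case using A(1) by (simp add: subalgebra_def subst_add)
    next
      case (mult p q)
      then show ?case using A(1) by (simp add: subalgebra_def subst_mult)
    qed
    then show "p \<in> A"
      using q(2) by simp
  qed
  have R: "subalgebra R"
    unfolding subalgebra_def
  proof (intro conjI ballI)
    show "range Const \<subseteq> R"
    proof
      fix p :: "(xy, 'k) mpoly" assume "p \<in> range Const"
      then obtain c where "p = subst (\<lambda>(i, j). bracket i j) (Const c)"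
        by auto
      moreover have "Const c \<in> polys_in V"
        by (simp add: polys_in_def)
      ultimately show "p \<in> R"
        unfolding R_def by blast
    qed
    fix p q assume "p \<in> R" "q \<in> R"
    then obtain p' q' where *: "p' \<in> polys_in V" "q' \<in> polys_in V"
      "p = subst (\<lambda>(i, j). bracket i j) p'" "q = subst (\<lambda>(i, j). bracket i j) q'"
      by (auto simp: R_def)
    have "p' + q' \<in> polys_in V" "p' * q' \<in> polys_in V"
      using * subalgebra_polys_in[of V] unfolding subalgebra_def by blast+
    then show "p + q \<in> R" "p * q \<in> R"
      unfolding R_def *(3,4) by (metis image_eqI subst_add, metis image_eqI subst_mult)
  qed
  have "bracket i j \<in> R" if "i \<in> {1..n}" "j \<in> {1..n}" for i j
  proof -
    have "bracket i j = subst (\<lambda>(i, j). bracket i j) (Var (i, j) :: (nat \<times> nat, 'k) mpoly)"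
      by simp
    moreover have "Var (i, j) \<in> (polys_in V :: (nat \<times> nat, 'k) mpoly set)"
      using that by (intro Var_in_polys_in) (simp add: V_def)
    ultimately show ?thesis
      unfolding R_def by blast
  qed
  moreover have "R \<subseteq> invariant_ring n"
    using bracket_in_invariant_ring by (intro R_subset subalgebra_invariant_ring) (auto simp: B_def)
  ultimately have inv_R: "invariant_ring n = R" and "B \<subseteq> R"
    using invariant_ring_subset[OF assms(1) R] by (auto simp: B_def)
  moreover have "generated_subalgebra B = R"
    unfolding generated_subalgebra_def using R \<open>B \<subseteq> R\<close> R_subset by (intro hull_unique) auto
  ultimately have "invariant_ring n = generated_subalgebra B"
    by simp
  moreover have "SL2_invariant p \<longleftrightarrow> (\<exists>q\<in>polys_in V. p = subst (\<lambda>(i, j). bracket i j) q)"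
    if "p \<in> Kxy n" for p :: "(xy, 'k) mpoly"
  proof -
    have "SL2_invariant p \<longleftrightarrow> p \<in> R"
      using that inv_R by (auto simp: invariant_ring_def)
    then show ?thesis
      by (auto simp: R_def)
  qed
  ultimately show ?thesis
    unfolding B_def V_def by blast
qed

end
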